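(* Let $s,d\ge 1$ be integers, let $p$ be a mixture density on $\mathbb{R}^{sd}$ as described in the context, and let $x_1,x_2,\dots$ be i.i.d. random vectors with density $p$. For $n\ge 2$ put $\delta_n=\left(\frac{\log n}{n}\right)^{\frac{1}{2+sd}}$ and let $\hat p_{\delta_n}$ be the spherical-kernel density estimator with bandwidth $\delta_n$ built from $x_1,\dots,x_n$. Then there is a constant $c'>0$, independent of $n$, such that for every $n\ge 2$, with probability at least $1-\frac{2}{n}$, $$\|\hat p_{\delta_n}-p\|_\infty\le c'\left(\frac{\log n}{n}\right)^{\frac{1}{2+sd}}.$$
   Context: Density assumptions. $p=\sum_{i=1}^{C}\pi_i p_i$ with $C$ a positive integer, $\pi_i\ge 0$, $\sum_{i=1}^C\pi_i=1$, where each $p_i:\mathbb{R}^{sd}\to[0,\infty)$ is a Lebesgue probability density such that: $p_i$ is supported on a compact subset of $[0,1]^{sd}$, and $p_i(x)=0$ for $x\notin[0,1]^{sd}$; $p_i$ is $l_p$-Lipschitz, i.e. $|p_i(x)-p_i(y)|\le l_p\|x-y\|$ for all $x,y\in\mathbb{R}^{sd}$ (Euclidean norm, common constant $l_p$); $p_i$ is unimodal, i.e. $\{x\in\mathbb{R}^{sd}:p_i(x)\ge a\}$ is convex for every $a\in[0,\|p_i\|_\infty]$. Moreover there are pairwise disjoint compact sets $S_1,\dots,S_C\subset[0,1]^{sd}$ and a constant $\lambda_*$ such that $p_i(x)\ge 0$ for $x\in S_i$ and $p_i(x)<\lambda_*$ for $x\notin S_i$. Kernel density estimator. $B(x,r)$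 is the closed Euclidean ball in $\mathbb{R}^{sd}$, $v_{sd}$ is the Lebesgue measure of $B(0,1)$, $K(x)=\mathbf 1_{x\in B(0,1)}$, and for $\delta>0$ $$\hat p_\delta(x)=\frac{1}{n\delta^{sd}v_{sd}}\sum_{i=1}^n K\left(\frac{x-x_i}{\delta}\right),\qquad x\in\mathbb{R}^{sd}.$$ $\|\cdot\|_\infty$ is the supremum norm over $\mathbb{R}^{sd}$. *)

theory Defs
  imports "HOL-Probability.Probability"
begin

text \<open>Extended-real valued, so that the supremum is meaningful for every function.\<close>

definition sup_norm :: "('a \<Rightarrow> real) \<Rightarrow> ereal" where
  "sup_norm f = (SUP x. ereal \<bar>f x\<bar>)"

definition lebesgue_density :: "('a::euclidean_space \<Rightarrow> real) \<Rightarrow> bool" where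
  "lebesgue_density f \<longleftrightarrow>
     f \<in> borel_measurable lborel \<and> (\<forall>x. 0 \<le> f x) \<and> (\<integral>\<^sup>+ x. ennreal (f x) \<partial>lborel) = 1"

definition unimodal :: "('a::real_vector \<Rightarrow> real) \<Rightarrow> bool" where
  "unimodal f \<longleftrightarrow> (\<forall>a. 0 \<le> a \<and> ereal a \<le> sup_norm f \<longrightarrow> convex {x. f x \<ge> a})"

text \<open>On \<^typ>\<open>real ^ 'm\<close> the constant 1 is the all-ones vector, so this is the unit cube.\<close>

abbreviation unit_cube :: "(real ^ 'm) set" where
  "unit_cube \<equiv> cbox 0 1"

definition mixture_component :: "real \<Rightarrow> (real ^ 'm \<Rightarrow> real) \<Rightarrow> bool" where
  "mixture_component l f \<longleftrightarrow>
     lebesgue_density f \<and>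
     (\<exists>A. compact A \<and> A \<subseteq> unit_cube \<and> (\<forall>x. x \<notin> A \<longrightarrow> f x = 0)) \<and>
     (\<forall>x. x \<notin> unit_cube \<longrightarrow> f x = 0) \<and>
     l-lipschitz_on UNIV f \<and>
     unimodal f"

text \<open>The condition \<open>0 \<le> f i x\<close> on \<open>S i\<close> is implied by \<^const>\<open>lebesgue_density\<close>.\<close>

definition mixture_density :: "(real ^ 'm \<Rightarrow> real) \<Rightarrow> bool" where
  "mixture_density p \<longleftrightarrow>
     (\<exists>(C::nat) w f l.
        C \<ge> 1 \<and>
        (\<forall>i\<in>{1..C}. (w i :: real) \<ge> 0) \<and> (\<Sum>i=1..C. w i) = 1 \<and>
        (\<forall>i\<in>{1..C}. mixture_component l (f i)) \<and>
        (\<forall>x. p x = (\<Sum>i=1..C. w i * f i x)) \<and>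
        (\<exists>S lam. disjoint_family_on S {1..C} \<and>
           (\<forall>i\<in>{1..C}. compact (S i) \<and> S i \<subseteq> unit_cube \<and>
              (\<forall>x\<in>S i. f i x \<ge> 0) \<and> (\<forall>x. x \<notin> S i \<longrightarrow> f i x < lam))))"

definition spherical_kernel :: "real ^ 'm \<Rightarrow> real" where
  "spherical_kernel = indicator (cball 0 1)"

definition kde :: "nat \<Rightarrow> real \<Rightarrow> (nat \<Rightarrow> real ^ 'm) \<Rightarrow> real ^ 'm \<Rightarrow> real" where
  "kde n \<delta> xs x =
     1 / (real n * \<delta> ^ CARD('m) * measure lborel (cball (0 :: real ^ 'm) 1)) *
     (\<Sum>i=1..n. spherical_kernel ((x - xs i) /\<^sub>R \<delta>))"

definition bandwidth :: "nat \<Rightarrow> nat \<Rightarrow> real" where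
  "bandwidth D n = (ln (real n) / real n) powr (1 / (2 + real D))"

end

theory Submission imports Defs begin

text \<open>The bandwidth satisfies \<open>\<delta> ^ (D + 2) = ln n / n\<close>.  The bias of the estimator is at most
  \<open>L * \<delta>\<close> because \<open>p\<close> is \<open>L\<close>-Lipschitz.  For the fluctuations, take a grid of mesh
  \<open>\<delta>\<^sup>2\<close> around the unit cube; it has \<open>O(n\<^sup>2)\<close> points.  A ball of radius \<open>\<delta>\<close> lies
  between the concentric balls of radii \<open>\<delta> \<plusminus> \<delta>\<^sup>2\<close> about a nearby grid point, whose volumes
  differ from its own by a factor \<open>1 + O(\<delta>)\<close>.  The Chernoff bound with parameter \<open>\<theta> = \<plusminus>\<delta>\<close>
  shows that the number of sample points in such a ball deviates from its mean by
  \<open>c * n * \<delta> ^ (D + 1)\<close> with probability at most \<open>exp (M' * n * \<delta> ^ (D + 2) - c * n * \<delta> ^ (D + 2))\<close>,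
  which is \<open>n powr (M' - c)\<close>; for large \<open>c\<close> the union bound over the grid leaves \<open>2 / n\<close>.\<close>

section \<open>Exponential moments and the Chernoff bound\<close>

text \<open>For negative \<open>x\<close> put \<open>z = -x\<close>. Multiplied by
  \<open>exp z\<close>, with \<open>exp z\<close> bounded below by its quadratic Taylor polynomial,
  the claim becomes that a product of two polynomials is at least 1, and expanding it leaves 1 plus
  nonnegative terms.\<close>

lemma exp_le_quadratic:
  fixes x :: real
  assumes "\<bar>x\<bar> \<le> 1"
  shows "exp x \<le> 1 + x + x\<^sup>2"
proof (cases "x \<ge> 0")
  case True
  then show ?thesis
    using assms exp_bound by auto
next
  case False
  define z where "z = -x"
  have z: "z \<ge> 0"
    using False by (simp add: z_def)
  have "0 \<le> z^2/2 + z^3/2 + z^4/2"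
    using z by simp
  moreover have "(1 - z + z\<^sup>2) * (1 + z + z\<^sup>2/2) = 1 + (z^2/2 + z^3/2 + z^4/2)"
    by (simp add: field_simps power2_eq_square power3_eq_cube power4_eq_xxxx)
  ultimately have "1 \<le> (1 - z + z\<^sup>2) * (1 + z + z\<^sup>2/2)"
    by linarith
  also have "\<dots> \<le> (1 - z + z\<^sup>2) * exp z"
  proof (rule mult_left_mono[OF exp_lower_Taylor_quadratic[OF z]])
    show "0 \<le> 1 - z + z\<^sup>2"
      using assms by (simp add: z_def)
  qed
  finally show ?thesis
    by (simp add: z_def exp_minus field_simps)
qed

text \<open>Markov's inequality for the exponential of \<theta> times the count. Each factor has
  mean \<open>1 + (exp \<theta> - 1) * q\<close>, at most
  \<open>exp (q * (\<theta> + \<theta>\<^sup>2))\<close>; the part linear in \<theta> cancels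
  against the threshold. The sign of \<theta> is free: positive values give the upper tail, negative
  values the lower tail.\<close>

lemma (in prob_space) chernoff_count:
  fixes X :: "'i \<Rightarrow> 'a \<Rightarrow> 'b::topological_space" and q \<theta> T :: real
  assumes fin: "finite I" and ind: "indep_vars (\<lambda>_. borel) X I"
    and A: "A \<in> sets borel"
    and q: "\<And>i. i \<in> I \<Longrightarrow> prob {\<omega> \<in> space M. X i \<omega> \<in> A} = q"
    and \<theta>: "\<bar>\<theta>\<bar> \<le> 1"
  shows "prob {\<omega> \<in> space M. \<theta> * (card I * q) + T \<le> \<theta> * (\<Sum>i\<in>I. indicator A (X i \<omega>))}
           \<le> exp (card I * q * \<theta>\<^sup>2 - T)"
\<comment> \<open>For empty \<open>I\<close> nothing ties \<open>q\<close> to a probability, so its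
  sign is unknown; mean and count are then both 0.\<close>
proof (cases "I = {}")
  case True
  show ?thesis
  proof (cases "T \<le> 0")
    case True
    then show ?thesis
      using \<open>I = {}\<close> by (auto intro: order.trans[OF prob_le_1])
  next
    case False
    then have "{\<omega> \<in> space M. \<theta> * (card I * q) + T \<le> \<theta> * (\<Sum>i\<in>I. indicator A (X i \<omega>))} = {}"
      using \<open>I = {}\<close> by auto
    then show ?thesis
      by (simp only: measure_empty exp_ge_zero)
  qed
next
  case False
  then have q0: "q \<ge> 0"
    using q measure_nonneg by (metis ex_in_conv)
  have rv [measurable]: "X i \<in> borel_measurable M" if "i \<in> I" for i
    using ind that unfolding indep_vars_def by auto
  note A[measurable]
  define Z where "Z i \<omega> = exp (\<theta> * indicator A (X i \<omega>))" for i \<omega>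
  \<comment> \<open>\<open>Z i\<close> takes only the values 1 and \<open>exp \<theta>\<close>, so
    it is affine in an indicator and its mean can be read off.\<close>
  have Zeq: "Z i \<omega> = 1 + (exp \<theta> - 1) * indicator {\<omega> \<in> space M. X i \<omega> \<in> A} \<omega>"
    if "\<omega> \<in> space M" for i \<omega>
    using that by (simp add: Z_def indicator_def)
  have int: "integrable M (\<lambda>\<omega>. 1 + (exp \<theta> - 1) * indicator {\<omega> \<in> space M. X i \<omega> \<in> A} \<omega> :: real)"
    if "i \<in> I" for i
    using that by (auto simp: emeasure_eq_measure)
  have intZ: "integrable M (Z i)" if "i \<in> I" for i
    using int[OF that] Zeq by (metis (no_types, lifting) Bochner_Integration.integrable_cong)
  have EZ: "expectation (Z i) = 1 + (exp \<theta> - 1) * q" if "i \<in> I" for i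
  proof -
    have "expectation (Z i) = expectation (\<lambda>\<omega>. 1 + (exp \<theta> - 1) * indicator {\<omega> \<in> space M. X i \<omega> \<in> A} \<omega>)"
      by (intro Bochner_Integration.integral_cong) (auto simp: Zeq)
    also have "\<dots> = 1 + (exp \<theta> - 1) * q"
      using that q[OF that] by (subst Bochner_Integration.integral_add)
         (auto simp: prob_space emeasure_eq_measure Collect_conj_eq Int_ac)
    finally show ?thesis .
  qed
  have indZ: "indep_vars (\<lambda>_. borel) Z I"
    unfolding Z_def by (rule indep_vars_compose2[OF ind]) auto
  have prodZ: "(\<Prod>i\<in>I. Z i \<omega>) = exp (\<theta> * (\<Sum>i\<in>I. indicator A (X i \<omega>)))" for \<omega>
    by (simp add: Z_def exp_sum[OF fin] sum_distrib_left)
  have E: "expectation (\<lambda>\<omega>. \<Prod>i\<in>I. Z i \<omega>) = (1 + (exp \<theta> - 1) * q) ^ card I"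
    using indep_vars_lebesgue_integral[OF fin indZ intZ] EZ by simp
  \<comment> \<open>Taking powers preserves the inequality only for a nonnegative base; here the
    base is the mean of a positive variable.\<close>
  have "0 \<le> 1 + (exp \<theta> - 1) * q"
  proof -
    obtain i where "i \<in> I" using False by auto
    then have "0 \<le> expectation (Z i)"
      by (intro integral_nonneg_AE) (auto simp: Z_def)
    then show ?thesis using EZ \<open>i \<in> I\<close> by simp
  qed
  moreover have "1 + (exp \<theta> - 1) * q \<le> exp (q * (\<theta> + \<theta>\<^sup>2))"
  proof -
    have "(exp \<theta> - 1) * q \<le> (\<theta> + \<theta>\<^sup>2) * q"
      using exp_le_quadratic[OF \<theta>] q0 by (intro mult_right_mono) auto
    then show ?thesis
      using exp_ge_add_one_self[of "q * (\<theta> + \<theta>\<^sup>2)"]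
      by (simp only: mult.commute[of _ q])
  qed
  ultimately have "(1 + (exp \<theta> - 1) * q) ^ card I \<le> exp (q * (\<theta> + \<theta>\<^sup>2)) ^ card I"
    by (intro power_mono) auto
  also have "\<dots> = exp (card I * (q * (\<theta> + \<theta>\<^sup>2)))"
    by (simp add: exp_of_nat_mult)
  finally have E': "expectation (\<lambda>\<omega>. \<Prod>i\<in>I. Z i \<omega>) \<le> exp (card I * (q * (\<theta> + \<theta>\<^sup>2)))"
    using E by simp
  let ?t = "\<theta> * (card I * q) + T"
  have "{\<omega> \<in> space M. ?t \<le> \<theta> * (\<Sum>i\<in>I. indicator A (X i \<omega>))}
      = {\<omega> \<in> space M. exp ?t \<le> (\<Prod>i\<in>I. Z i \<omega>)}"
    by (simp add: prodZ)
  also have "prob \<dots> \<le> expectation (\<lambda>\<omega>. \<Prod>i\<in>I. Z i \<omega>) / exp ?t"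
    by (intro integral_Markov_inequality_measure[where A = "{}"] indep_vars_integrable fin indZ intZ)
       (auto simp: prodZ)
  also have "\<dots> \<le> exp (card I * (q * (\<theta> + \<theta>\<^sup>2))) / exp ?t"
    by (intro divide_right_mono E') auto
  also have "\<dots> = exp (card I * q * \<theta>\<^sup>2 - T)"
    by (simp add: exp_diff[symmetric] algebra_simps)
  finally show ?thesis .
qed

section \<open>Ball probabilities under a Lipschitz density\<close>

text \<open>The probability is the integral of \<open>p\<close> over the ball, where
  \<open>p\<close> stays within \<open>L * r\<close> of its value at the centre.\<close>

lemma (in prob_space) prob_cball_lipschitz:
  fixes p :: "'b::euclidean_space \<Rightarrow> real"
  assumes X: "distributed M lborel X (\<lambda>x. ennreal (p x))"
    and p0: "\<And>x. 0 \<le> p x" and lip: "L-lipschitz_on UNIV p"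
  shows "\<bar>prob {\<omega> \<in> space M. X \<omega> \<in> cball g r} - p g * measure lborel (cball g r)\<bar>
           \<le> L * r * measure lborel (cball g r)"
proof -
  let ?I = "\<lambda>x. indicator (cball g r) x :: real"
  have [measurable]: "X \<in> borel_measurable M"
    using distributed_measurable[OF X] by simp
  have cont: "continuous_on UNIV p"
    using lip by (rule lipschitz_on_continuous_on)
  then have [measurable]: "p \<in> borel_measurable borel"
    by (rule borel_measurable_continuous_onI)
  have fin: "emeasure lborel (cball g r) < \<infinity>"
    by (rule emeasure_lborel_cball_finite)
  have intc: "integrable lborel (\<lambda>x. c * ?I x)" for c :: real
    using fin by (auto intro!: integrable_mult_right)
  have intp: "integrable lborel (\<lambda>x. p x * ?I x)"
    using borel_integrable_compact[of "cball g r" p] cont continuous_on_subset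
    by (auto simp: mult.commute indicator_def if_distrib cong: if_cong)
  have "prob {\<omega> \<in> space M. X \<omega> \<in> cball g r} = expectation (\<lambda>\<omega>. ?I (X \<omega>))"
  proof -
    have "expectation (\<lambda>\<omega>. ?I (X \<omega>)) = expectation (indicator {\<omega> \<in> space M. X \<omega> \<in> cball g r})"
      by (intro Bochner_Integration.integral_cong) (auto simp: indicator_def)
    also have "\<dots> = prob {\<omega> \<in> space M. X \<omega> \<in> cball g r}"
      by (simp add: Collect_conj_eq Int_ac)
    finally show ?thesis by simp
  qed
  also have "\<dots> = (\<integral>x. p x * ?I x \<partial>lborel)"
    by (rule distributed_integral[OF X, symmetric])
      (use p0 in \<open>simp_all add: borel_measurable_indicator closed_cball borel_closed\<close>)
  finally have P: "prob {\<omega> \<in> space M. X \<omega> \<in> cball g r} = (\<integral>x. p x * ?I x \<partial>lborel)" .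
  have ci: "(\<integral>x. c * ?I x \<partial>lborel) = c * measure lborel (cball g r)" for c :: real
    using fin by simp
  have near: "p x \<le> p g + L * r \<and> p g - L * r \<le> p x" if "x \<in> cball g r" for x
  proof -
    have "\<bar>p g - p x\<bar> \<le> L * dist g x"
      using lipschitz_onD[OF lip, of g x] by (simp add: dist_real_def)
    also have "\<dots> \<le> L * r"
      using that lipschitz_on_nonneg[OF lip] by (intro mult_left_mono) auto
    finally show ?thesis by linarith
  qed
  have "(\<integral>x. p x * ?I x \<partial>lborel) \<le> (\<integral>x. (p g + L * r) * ?I x \<partial>lborel)"
    using near by (intro integral_mono intp intc) (auto simp: indicator_def)
  moreover have "(\<integral>x. (p g - L * r) * ?I x \<partial>lborel) \<le> (\<integral>x. p x * ?I x \<partial>lborel)"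
    using near by (intro integral_mono intp intc) (auto simp: indicator_def)
  ultimately show ?thesis
    unfolding P ci by (simp add: abs_le_iff algebra_simps)
qed

section \<open>Finite grids around the unit cube\<close>

text \<open>Rounding each coordinate down to a multiple of \<open>h\<close> moves a point by at most
  \<open>h\<close> per coordinate. With \<open>h\<close> equal to \<eta> over the dimension, the l1
  distance, and hence the Euclidean one, is at most \<eta>. The cube of half-width 2 leaves a margin
  of 1 around the unit cube, so that balls of radius at most 1 about points outside it miss every
  sample.\<close>

lemma grid_cover:
  fixes \<eta> :: real
  assumes "0 < \<eta>" "\<eta> \<le> 1"
  obtains G :: "(real ^ 'm) set"
  where "finite G" "real (card G) \<le> (7 * CARD('m) / \<eta>) ^ CARD('m)"
    "\<And>x. (\<And>i. \<bar>x $ i\<bar> \<le> 2) \<Longrightarrow> \<exists>g\<in>G. dist x g \<le> \<eta>"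
proof -
  define h where "h = \<eta> / CARD('m)"
  have D: "real CARD('m) \<ge> 1"
    using zero_less_card_finite[where 'a='m] by linarith
  have h: "h > 0" "h \<le> 1"
    using assms D by (auto simp: h_def field_simps intro: order.trans)
  define K where "K = \<lceil>2 / h\<rceil>"
  define F where "F = (UNIV :: 'm set) \<rightarrow>\<^sub>E {-K..K}"
  define G where "G = (\<lambda>f. (\<chi> i. h * of_int (f i)) :: real ^ 'm) ` F"
  have "finite F"
    unfolding F_def by (intro finite_PiE) auto
  have K: "real_of_int K \<le> 2 / h + 1" "K \<ge> 0"
    using divide_pos_pos[of 2 h] h unfolding K_def by linarith+
  have "card G \<le> card F"
    unfolding G_def using \<open>finite F\<close> by (rule card_image_le)
  also have "card F = nat (2 * K + 1) ^ CARD('m)"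
    unfolding F_def by (subst card_funcsetE) (auto simp: algebra_simps)
  finally have "real (card G) \<le> real (nat (2 * K + 1)) ^ CARD('m)"
    by (metis of_nat_le_iff of_nat_power)
  also have "\<dots> \<le> (7 * CARD('m) / \<eta>) ^ CARD('m)"
  proof (intro power_mono)
    \<comment> \<open>The factor 7 is 4 + 3, since \<open>h \<le> 1\<close> gives
      \<open>3 \<le> 3 / h\<close>.\<close>
    have "real (nat (2 * K + 1)) \<le> 4 / h + 3"
      using K by simp
    also have "\<dots> \<le> 7 / h"
      using h by (simp add: field_simps)
    finally show "real (nat (2 * K + 1)) \<le> 7 * CARD('m) / \<eta>"
      by (simp add: h_def)
  qed simp
  finally have card: "real (card G) \<le> (7 * CARD('m) / \<eta>) ^ CARD('m)" .
  have cover: "\<exists>g\<in>G. dist x g \<le> \<eta>" if x: "\<And>i. \<bar>x $ i\<bar> \<le> 2" for x :: "real ^ 'm"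
  proof -
    define f where "f i = \<lfloor>x $ i / h\<rfloor>" for i
    have "f i \<in> {-K..K}" for i
    proof -
      have "- (2 / h) \<le> x $ i / h" "x $ i / h \<le> 2 / h"
        using x[of i] h by (auto simp: field_simps abs_le_iff)
      moreover have "2 / h \<le> real_of_int K"
        by (simp add: K_def)
      ultimately show ?thesis
        unfolding f_def by (simp add: floor_le_iff le_floor_iff)
    qed
    then have "f \<in> F"
      by (auto simp: F_def)
    moreover have "dist x (\<chi> i. h * of_int (f i)) \<le> \<eta>"
    proof -
      have "\<bar>x $ i - h * of_int (f i)\<bar> \<le> h" for i
      proof -
        have "x $ i - h * of_int (f i) = h * (x $ i / h - of_int (f i))"
          using h by (simp add: field_simps)
        also have "\<bar>\<dots>\<bar> \<le> h * 1"
          unfolding abs_mult using h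
          by (intro mult_mono) (auto simp: f_def abs_le_iff, linarith+)
        finally show ?thesis by simp
      qed
      then have "(\<Sum>i\<in>UNIV. \<bar>(x - (\<chi> i. h * of_int (f i))) $ i\<bar>) \<le> (\<Sum>i\<in>(UNIV::'m set). h)"
        by (intro sum_mono) simp
      also have "\<dots> = \<eta>"
        using D by (simp add: h_def)
      finally show ?thesis
        unfolding dist_norm using norm_le_l1_cart order.trans by blast
    qed
    ultimately show ?thesis
      unfolding G_def by blast
  qed
  have "finite G"
    using \<open>finite F\<close> by (simp add: G_def)
  then show ?thesis
    using card cover that by blast
qed

section \<open>Regularity of the mixture density\<close>

text \<open>Convex combinations keep the common Lipschitz constant, positivity and vanishing outside
  the cube. Boundedness then follows by comparison with a point outside the cube.\<close>

lemma mixture_density_props: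
  fixes p :: "real ^ 'm \<Rightarrow> real"
  assumes "mixture_density p"
  obtains L P where "L-lipschitz_on UNIV p" "\<And>x. 0 \<le> p x" "\<And>x. p x \<le> P"
    "\<And>x. x \<notin> unit_cube \<Longrightarrow> p x = 0"
proof -
  obtain C w f l where C: "(C::nat) \<ge> 1"
    and w: "\<And>i. i \<in> {1..C} \<Longrightarrow> (w i :: real) \<ge> 0" "(\<Sum>i=1..C. w i) = 1"
    and f: "\<And>i. i \<in> {1..C} \<Longrightarrow> mixture_component l (f i)"
    and p: "\<And>x. p x = (\<Sum>i=1..C. w i * f i x)"
    using assms unfolding mixture_density_def by blast
  have flip: "l-lipschitz_on UNIV (f i)" and f0: "0 \<le> f i x"
    and fcube: "x \<notin> unit_cube \<Longrightarrow> f i x = 0" if "i \<in> {1..C}" for i x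
    using f[OF that] by (auto simp: mixture_component_def lebesgue_density_def)
  have l0: "l \<ge> 0"
    using flip[of 1] C lipschitz_on_nonneg by auto
  have lip: "l-lipschitz_on UNIV p"
  proof (rule lipschitz_onI[OF _ l0])
    fix x y :: "real ^ 'm"
    have "\<bar>p x - p y\<bar> = \<bar>\<Sum>i=1..C. w i * (f i x - f i y)\<bar>"
      by (simp add: p sum_subtractf algebra_simps)
    also have "\<dots> \<le> (\<Sum>i=1..C. w i * (l * dist x y))"
    proof (rule order.trans[OF sum_abs], rule sum_mono)
      fix i assume i: "i \<in> {1..C}"
      have "\<bar>f i x - f i y\<bar> \<le> l * dist x y"
        using lipschitz_onD[OF flip[OF i], of x y] by (simp add: dist_real_def)
      then show "\<bar>w i * (f i x - f i y)\<bar> \<le> w i * (l * dist x y)"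
        using w(1)[OF i] by (simp add: abs_mult mult_left_mono)
    qed
    also have "\<dots> = l * dist x y"
      using w(2) by (simp flip: sum_distrib_right)
    finally show "dist (p x) (p y) \<le> l * dist x y"
      by (simp add: dist_real_def)
  qed
  have p0: "0 \<le> p x" for x
    unfolding p using w f0 by (intro sum_nonneg mult_nonneg_nonneg) auto
  have pcube: "p x = 0" if "x \<notin> unit_cube" for x
    unfolding p using fcube that by (intro sum.neutral) auto
  \<comment> \<open>Translation by \<open>vec 2\<close> carries each point of the cube to a point
    where \<open>p\<close> vanishes, so the Lipschitz condition over this fixed distance bounds
    \<open>p\<close>.\<close>
  have "p x \<le> l * norm (vec 2 :: real ^ 'm)" for x
  proof (cases "x \<in> unit_cube")
    case True
    then have ge0: "0 \<le> x $ i" for i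
      by (simp add: mem_box_cart)
    have "\<not> (x + vec 2) $ i \<le> 1" for i
      using ge0[of i] by simp
    then have "x + vec 2 \<notin> unit_cube"
      by (auto simp: mem_box_cart)
    then have "p (x + vec 2) = 0"
      by (rule pcube)
    then show ?thesis
      using lipschitz_onD[OF lip, of x "x + vec 2"] by (simp add: dist_norm p0)
  qed (use l0 pcube in auto)
  then show ?thesis
    using that lip p0 pcube by blast
qed

section \<open>Measurability of the uniform deviation event\<close>

text \<open>Compactness replaces the uncountable union over \<open>K\<close> by countable
  operations: the balls meet in \<open>K\<close> iff, for each \<open>k\<close>, the balls enlarged
  by \<open>1 / Suc k\<close> share a point of a countable dense subset of \<open>K\<close>. In the
  converse direction a limit of a subsequence of these points lies in all the original
  balls.\<close>

lemma measurable_common_point_cballs: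
  fixes X :: "'i \<Rightarrow> 'w \<Rightarrow> 'a::euclidean_space"
  assumes fin: "finite I" and X: "\<And>i. i \<in> I \<Longrightarrow> X i \<in> borel_measurable M" and K: "compact K"
  shows "{\<omega> \<in> space M. \<exists>x\<in>K. \<forall>i\<in>I. dist x (X i \<omega>) \<le> r} \<in> sets M"
proof -
  obtain T where T: "countable T" "T \<subseteq> K" "K \<subseteq> closure T"
    using separable by blast
  have "(\<exists>x\<in>K. \<forall>i\<in>I. dist x (X i \<omega>) \<le> r) \<longleftrightarrow>
        (\<forall>k. \<exists>t\<in>T. \<forall>i\<in>I. dist t (X i \<omega>) \<le> r + 1 / real (Suc k))" for \<omega>
  proof
    assume "\<exists>x\<in>K. \<forall>i\<in>I. dist x (X i \<omega>) \<le> r"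
    then obtain x where x: "x \<in> K" "\<forall>i\<in>I. dist x (X i \<omega>) \<le> r" by auto
    show "\<forall>k. \<exists>t\<in>T. \<forall>i\<in>I. dist t (X i \<omega>) \<le> r + 1 / real (Suc k)"
    proof
      fix k
      obtain t where t: "t \<in> T" "dist t x < 1 / real (Suc k)"
        using x(1) T(3) closure_approachable[of x T] by (metis of_nat_0_less_iff subsetD zero_less_Suc zero_less_divide_1_iff)
      have "dist t (X i \<omega>) \<le> r + 1 / real (Suc k)" if "i \<in> I" for i
        using dist_triangle[of t "X i \<omega>" x] t(2) x(2) that by fastforce
      then show "\<exists>t\<in>T. \<forall>i\<in>I. dist t (X i \<omega>) \<le> r + 1 / real (Suc k)"
        using t(1) by blast
    qed
  next
    assume "\<forall>k. \<exists>t\<in>T. \<forall>i\<in>I. dist t (X i \<omega>) \<le> r + 1 / real (Suc k)"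
    then obtain t where t: "\<And>k. t k \<in> T" "\<And>k i. i \<in> I \<Longrightarrow> dist (t k) (X i \<omega>) \<le> r + 1 / real (Suc k)"
      by metis
    then obtain x \<phi> where x: "x \<in> K" "strict_mono \<phi>" "(t \<circ> \<phi>) \<longlonglongrightarrow> x"
      using K T(2) unfolding compact_def by (metis subsetD)
    have "dist x (X i \<omega>) \<le> r" if i: "i \<in> I" for i
    proof (rule LIMSEQ_le)
      show "(\<lambda>k. dist ((t \<circ> \<phi>) k) (X i \<omega>)) \<longlonglongrightarrow> dist x (X i \<omega>)"
        by (intro tendsto_dist x tendsto_const)
      have "(\<lambda>k. r + 1 / real (Suc k)) \<longlonglongrightarrow> r + 0"
        by (intro tendsto_add tendsto_const) (rule LIMSEQ_Suc[OF lim_1_over_n])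
      from LIMSEQ_subseq_LIMSEQ[OF this x(2)]
      show "((\<lambda>k. r + 1 / real (Suc k)) \<circ> \<phi>) \<longlonglongrightarrow> r"
        by simp
      show "\<exists>N. \<forall>n\<ge>N. dist ((t \<circ> \<phi>) n) (X i \<omega>) \<le> ((\<lambda>k. r + 1 / real (Suc k)) \<circ> \<phi>) n"
        using t(2)[OF i] by (auto simp: comp_def)
    qed
    then show "\<exists>x\<in>K. \<forall>i\<in>I. dist x (X i \<omega>) \<le> r"
      using x(1) by blast
  qed
  moreover have "{\<omega> \<in> space M. \<forall>k. \<exists>t\<in>T. \<forall>i\<in>I. dist t (X i \<omega>) \<le> r + 1 / real (Suc k)} \<in> sets M"
    by (intro sets.sets_Collect_countable_All sets.sets_Collect_countable_Ex' T(1) sets.sets_Collect_finite_All fin) 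
       (use X in measurable)
  ultimately show ?thesis
    by simp
qed

text \<open>The supremum over \<open>x\<close> cannot be restricted to a countable dense set: the closed balls around
  the sample points may meet in a single point.  The upper deviation is therefore reduced to the
  existence of a common point of finitely many balls inside a compact set.\<close>

lemma measurable_uniform_deviation:
  fixes X :: "'i \<Rightarrow> 'w \<Rightarrow> 'a::euclidean_space" and p :: "'a \<Rightarrow> real"
  assumes fin: "finite I" and X: "\<And>i. i \<in> I \<Longrightarrow> X i \<in> borel_measurable M"
    and p: "continuous_on UNIV p" and a: "a \<ge> 0"
  shows "{\<omega> \<in> space M. \<forall>x. \<bar>a * (\<Sum>i\<in>I. indicator (cball x r) (X i \<omega>)) - p x\<bar> \<le> c} \<in> sets M"
proof -
  define N where "N x \<omega> = (\<Sum>i\<in>I. indicator (cball x r) (X i \<omega>) :: real)" for x \<omega>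
  have N_eq: "N x \<omega> = real (card {i\<in>I. dist x (X i \<omega>) \<le> r})" for x \<omega>
    using fin by (simp add: N_def indicator_def sum.If_cases Int_def)
  \<comment> \<open>The strict inequality is exhausted by closed conditions with slack
    \<open>1 / Suc j\<close>, and space by balls of radius \<open>j\<close>; one index controls
    both, so each \<open>K J j\<close> is compact.\<close>
  define K where "K J j = {x \<in> cball 0 (real j). p x \<le> a * real (card J) - c - 1 / real (Suc j)}" for J :: "'i set" and j
  have K: "compact (K J j)" for J j
  proof -
    have "closed {x. p x \<le> a * real (card J) - c - 1 / real (Suc j)}"
      by (intro closed_Collect_le p continuous_on_const)
    then have "compact (cball 0 (real j) \<inter> {x. p x \<le> a * real (card J) - c - 1 / real (Suc j)})"
      by (intro compact_Int_closed) auto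
    then show ?thesis by (simp add: K_def Int_def)
  qed
  have upper: "(\<exists>x. c < a * N x \<omega> - p x) \<longleftrightarrow>
      (\<exists>J\<in>Pow I. \<exists>j. \<exists>x\<in>K J j. \<forall>i\<in>J. dist x (X i \<omega>) \<le> r)" for \<omega>
  proof
    assume "\<exists>x. c < a * N x \<omega> - p x"
    then obtain x where x: "c < a * N x \<omega> - p x" by auto
    define J where "J = {i\<in>I. dist x (X i \<omega>) \<le> r}"
    obtain j where j: "1 / real (Suc j) < a * N x \<omega> - p x - c"
      using x nat_approx_posE[of "a * N x \<omega> - p x - c"] by auto
    obtain j' where j': "norm x \<le> real j'"
      using real_arch_simple by blast
    have "1 / real (Suc (max j j')) \<le> 1 / real (Suc j)"
      by (intro divide_left_mono) auto
    then have "x \<in> K J (max j j')"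
      using j j' N_eq[of x \<omega>] by (simp add: K_def J_def)
    moreover have "J \<in> Pow I" "\<forall>i\<in>J. dist x (X i \<omega>) \<le> r"
      by (auto simp: J_def)
    ultimately show "\<exists>J\<in>Pow I. \<exists>j. \<exists>x\<in>K J j. \<forall>i\<in>J. dist x (X i \<omega>) \<le> r"
      by blast
  next
    assume "\<exists>J\<in>Pow I. \<exists>j. \<exists>x\<in>K J j. \<forall>i\<in>J. dist x (X i \<omega>) \<le> r"
    then obtain J j x where J: "J \<subseteq> I" "x \<in> K J j" "\<forall>i\<in>J. dist x (X i \<omega>) \<le> r" by auto
    \<comment> \<open>A common point of the balls in \<open>J\<close> may lie in further balls,
      which only raises the count and so keeps the upper deviation.\<close>
    have "card J \<le> card {i\<in>I. dist x (X i \<omega>) \<le> r}"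
      using J fin by (intro card_mono) auto
    then have "a * real (card J) \<le> a * N x \<omega>"
      using a by (auto simp: N_eq intro: mult_left_mono)
    moreover have "p x \<le> a * real (card J) - c - 1 / real (Suc j)" "1 / real (Suc j) > 0"
      using J(2) by (auto simp: K_def)
    ultimately have "c < a * N x \<omega> - p x"
      by linarith
    then show "\<exists>x. c < a * N x \<omega> - p x" ..
  qed
  obtain Q :: "'a set" where Q: "countable Q" "\<And>U. open U \<Longrightarrow> U \<noteq> {} \<Longrightarrow> \<exists>q\<in>Q. q \<in> U"
    using countable_dense_setE by blast
  \<comment> \<open>For the lower deviation a dense set does suffice: the balls are closed, so the
    count cannot increase near \<open>x\<close> and the strict inequality persists on a
    neighbourhood.\<close>
  have lower: "(\<exists>x. c < p x - a * N x \<omega>) \<longleftrightarrow> (\<exists>q\<in>Q. c < p q - a * N q \<omega>)" for \<omega>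
  proof
    assume "\<exists>x. c < p x - a * N x \<omega>"
    then obtain x where x: "c < p x - a * N x \<omega>" by auto
    define J where "J = {i\<in>I. \<not> dist x (X i \<omega>) \<le> r}"
    \<comment> \<open>The neighbourhood avoids every ball that does not already contain
      \<open>x\<close>.\<close>
    define U where "U = {y. c + a * N x \<omega> < p y} \<inter> (\<Inter>i\<in>J. - cball (X i \<omega>) r)"
    have "open U"
      unfolding U_def using fin
      by (intro open_Int open_INT open_Collect_less p continuous_on_const) (auto simp: J_def open_Compl)
    moreover have "x \<in> U"
      using x by (auto simp: U_def J_def dist_commute)
    ultimately obtain q where q: "q \<in> Q" "q \<in> U"
      using Q(2) by blast
    have "{i\<in>I. dist q (X i \<omega>) \<le> r} \<subseteq> {i\<in>I. dist x (X i \<omega>) \<le> r}"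
      using q(2) by (auto simp: U_def J_def dist_commute)
    then have "N q \<omega> \<le> N x \<omega>"
      unfolding N_eq using fin by (intro of_nat_mono card_mono) auto
    then have "a * N q \<omega> \<le> a * N x \<omega>"
      using a by (rule mult_left_mono)
    then have "c < p q - a * N q \<omega>"
      using q(2) by (auto simp: U_def)
    then show "\<exists>q\<in>Q. c < p q - a * N q \<omega>"
      using q(1) by blast
  qed auto
  have "{\<omega> \<in> space M. \<exists>x. c < a * N x \<omega> - p x} \<in> sets M"
    unfolding upper
  proof (rule sets.sets_Collect_finite_Ex, rule sets.sets_Collect_countable_Ex)
    show "{\<omega> \<in> space M. \<exists>x\<in>K J j. \<forall>i\<in>J. dist x (X i \<omega>) \<le> r} \<in> sets M" if "J \<in> Pow I" for J j
      using that X fin by (intro measurable_common_point_cballs K) (auto intro: finite_subset)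
  qed (use fin in auto)
  moreover have "{\<omega> \<in> space M. \<exists>x. c < p x - a * N x \<omega>} \<in> sets M"
    unfolding lower
  proof (intro sets.sets_Collect_countable_Ex' Q(1))
    fix q
    have "N q \<in> borel_measurable M"
      unfolding N_def[abs_def]
      by (intro borel_measurable_sum measurable_compose[OF X] borel_measurable_indicator) auto
    then show "{\<omega> \<in> space M. c < p q - a * N q \<omega>} \<in> sets M"
      by measurable
  qed
  ultimately have "space M - ({\<omega> \<in> space M. \<exists>x. c < a * N x \<omega> - p x} \<union> {\<omega> \<in> space M. \<exists>x. c < p x - a * N x \<omega>}) \<in> sets M"
    by auto
  also have "space M - ({\<omega> \<in> space M. \<exists>x. c < a * N x \<omega> - p x} \<union> {\<omega> \<in> space M. \<exists>x. c < p x - a * N x \<omega>})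
      = {\<omega> \<in> space M. \<forall>x. \<bar>a * N x \<omega> - p x\<bar> \<le> c}"
    by (auto simp: abs_le_iff not_less) (meson leD)+
  finally show ?thesis
    by (simp add: N_def)
qed

section \<open>Comparison of the estimator with counts at grid points\<close>

lemma kde_eq:
  fixes x :: "real ^ 'm"
  assumes "\<delta> > 0"
  shows "kde n \<delta> xs x = 1 / (real n * \<delta> ^ CARD('m) * measure lborel (cball (0 :: real ^ 'm) 1)) *
     (\<Sum>i\<in>{1..n}. indicator (cball x \<delta>) (xs i))"
proof -
  have "norm ((x - xs i) /\<^sub>R \<delta>) = dist x (xs i) / \<delta>" for i
    using assms by (simp only: norm_scaleR dist_norm) (simp add: divide_inverse)
  then have "spherical_kernel ((x - xs i) /\<^sub>R \<delta>) = indicator (cball x \<delta>) (xs i)" for i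
    using assms by (simp add: spherical_kernel_def indicator_def pos_divide_le_eq del: norm_scaleR)
  then show ?thesis
    by (simp add: kde_def)
qed

lemma measure_cball_scale:
  fixes g :: "'a::euclidean_space"
  assumes "r \<ge> 0"
  shows "measure lborel (cball g r) = measure lborel (cball (0::'a) 1) * r ^ DIM('a)"
  using assms by (simp add: content_cball)

text \<open>By convexity the power lies below its chord over [0, 1], with end values 1 and
  \<open>2 ^ k\<close>. The induction replaces one factor \<open>1 + x\<close> by 2.\<close>

lemma one_plus_power_le:
  fixes x :: real
  assumes "0 \<le> x" "x \<le> 1"
  shows "(1 + x) ^ k \<le> 1 + (2 ^ k - 1) * x"
proof (induction k)
  case (Suc k)
  have "(1 + x) ^ Suc k \<le> (1 + (2 ^ k - 1) * x) * (1 + x)"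
    using Suc assms by (simp add: mult.commute mult_right_mono)
  also have "\<dots> = 1 + x + (2 ^ k - 1) * (x * (1 + x))"
    by (simp add: algebra_simps)
  also have "\<dots> \<le> 1 + x + (2 ^ k - 1) * (x * 2)"
    using assms by (intro add_left_mono mult_left_mono) auto
  also have "\<dots> = 1 + (2 ^ Suc k - 1) * x"
    by (simp add: algebra_simps)
  finally show ?case .
qed simp

lemma one_minus_power_le:
  fixes x :: real
  assumes "0 \<le> x" "x \<le> 1"
  shows "1 - real k * x \<le> (1 - x) ^ k"
  using Bernoulli_inequality[of "-x" k] assms by simp

text \<open>Since \<open>cball g (\<delta> - \<delta>\<^sup>2) \<subseteq> cball x \<delta> \<subseteq> cball g (\<delta> + \<delta>\<^sup>2)\<close>, control of the counts
  at the grid point \<open>g\<close> controls the estimator at \<open>x\<close>.\<close>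

lemma kde_sandwich:
  fixes p :: "real ^ 'm \<Rightarrow> real" and x g :: "real ^ 'm" and xs :: "nat \<Rightarrow> real ^ 'm"
    and \<delta> c q\<^sub>1 q\<^sub>2 :: real
  defines "D \<equiv> CARD('m)" and "v \<equiv> measure lborel (cball (0 :: real ^ 'm) 1)"
  assumes \<delta>: "0 < \<delta>" "\<delta> \<le> 1" and n: "n \<ge> 1" and c: "c \<ge> 0"
    and lip: "L-lipschitz_on UNIV p" and p0: "\<And>x. 0 \<le> p x" and pP: "\<And>x. p x \<le> P"
    and g: "dist x g \<le> \<delta>\<^sup>2"
    and q1: "q\<^sub>1 \<le> (p g + L * (\<delta> + \<delta>\<^sup>2)) * (v * (\<delta> + \<delta>\<^sup>2) ^ D)"
    and q2: "(p g - L * (\<delta> - \<delta>\<^sup>2)) * (v * (\<delta> - \<delta>\<^sup>2) ^ D) \<le> q\<^sub>2"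
    and up: "(\<Sum>i\<in>{1..n}. indicator (cball g (\<delta> + \<delta>\<^sup>2)) (xs i)) \<le> n * q\<^sub>1 + c * n * \<delta> ^ (D + 1)"
    and lo: "n * q\<^sub>2 - c * n * \<delta> ^ (D + 1) \<le> (\<Sum>i\<in>{1..n}. indicator (cball g (\<delta> - \<delta>\<^sup>2)) (xs i))"
  shows "\<bar>kde n \<delta> xs x - p x\<bar> \<le> (2 ^ D * P + real D * P + (2 * 2 ^ D + 2) * L + c / v) * \<delta>"
proof -
  have v: "v > 0"
    unfolding v_def by (rule content_cball_pos) simp
  have L: "L \<ge> 0"
    using lip by (rule lipschitz_on_nonneg)
  have P: "P \<ge> 0"
    using p0[of x] pP[of x] by linarith
  have \<delta>2: "\<delta>\<^sup>2 \<le> \<delta>"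
    using \<delta> by (simp add: power2_eq_square mult_left_le)
  have pxg: "\<bar>p x - p g\<bar> \<le> L * \<delta>"
  proof -
    have "\<bar>p x - p g\<bar> \<le> L * dist x g"
      using lipschitz_onD[OF lip, of x g] by (simp add: dist_real_def)
    also have "\<dots> \<le> L * \<delta>"
      using g \<delta>2 L by (intro mult_left_mono) auto
    finally show ?thesis .
  qed
  \<comment> \<open>Division by the normalising constant \<open>a\<close> turns the volume of a ball
    of radius \<open>\<delta> * z\<close> into the factor \<open>z ^ D\<close>, and the allowed
    deviation of the count into \<open>c / v * \<delta>\<close>.\<close>
  define a where "a = n * \<delta> ^ D * v"
  have a: "a > 0"
    using n \<delta> v by (simp add: a_def)
  have can: "(n * (y * (v * (\<delta> * z) ^ D))) / a = y * z ^ D" for y z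
    using n \<delta> v by (simp add: a_def power_mult_distrib field_simps)
  have cterm: "(c * n * \<delta> ^ (D + 1)) / a = c / v * \<delta>"
    using n \<delta> v by (simp add: a_def field_simps)
  let ?N = "\<lambda>y r. (\<Sum>i\<in>{1..n}. indicator (cball y r) (xs i)) :: real"
  have kde: "kde n \<delta> xs x = ?N x \<delta> / a"
    using kde_eq[OF \<delta>(1), of n xs x] by (simp add: a_def v_def D_def)
  have e1: "\<delta> + \<delta>\<^sup>2 = \<delta> * (1 + \<delta>)" and e2: "\<delta> - \<delta>\<^sup>2 = \<delta> * (1 - \<delta>)"
    by (simp_all add: power2_eq_square algebra_simps)
  have "?N x \<delta> \<le> ?N g (\<delta> + \<delta>\<^sup>2)"
  proof (rule sum_mono)
    fix i
    have "cball x \<delta> \<subseteq> cball g (\<delta> + \<delta>\<^sup>2)"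
      using g by (intro cball_subset_cball_iff[THEN iffD2]) (simp add: dist_commute)
    then show "indicator (cball x \<delta>) (xs i) \<le> (indicator (cball g (\<delta> + \<delta>\<^sup>2)) (xs i) :: real)"
      by (auto simp: indicator_def)
  qed
  also have "\<dots> \<le> n * ((p g + L * (\<delta> + \<delta>\<^sup>2)) * (v * (\<delta> + \<delta>\<^sup>2) ^ D)) + c * n * \<delta> ^ (D + 1)"
    using up q1 by (meson add_right_mono mult_left_mono of_nat_0_le_iff order_trans)
  finally have "?N x \<delta> / a \<le> (n * ((p g + L * (\<delta> + \<delta>\<^sup>2)) * (v * (\<delta> + \<delta>\<^sup>2) ^ D)) + c * n * \<delta> ^ (D + 1)) / a"
    using a by (intro divide_right_mono) auto
  also have "\<dots> = (p g + L * (\<delta> + \<delta>\<^sup>2)) * (1 + \<delta>) ^ D + c / v * \<delta>"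
    unfolding add_divide_distrib cterm e1 can ..
  \<comment> \<open>The volume excess of the larger ball costs \<open>2 ^ D * P * \<delta>\<close>;
    the oscillation of \<open>p\<close> on it, at most \<open>2 * L * \<delta>\<close>, is magnified
    by at most \<open>2 ^ D\<close>. Passing from \<open>p g\<close> to \<open>p x\<close>
    afterwards adds one more \<open>L * \<delta>\<close>.\<close>
  also have "(p g + L * (\<delta> + \<delta>\<^sup>2)) * (1 + \<delta>) ^ D \<le> p g + 2 ^ D * P * \<delta> + 2 ^ D * (2 * L * \<delta>)"
  proof -
    have "p g * (1 + \<delta>) ^ D \<le> p g * (1 + (2 ^ D - 1) * \<delta>)"
      using one_plus_power_le[of \<delta> D] \<delta> p0 by (intro mult_left_mono) auto
    also have "\<dots> = p g + p g * ((2 ^ D - 1) * \<delta>)"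
      by (simp add: algebra_simps)
    also have "\<dots> \<le> p g + P * (2 ^ D * \<delta>)"
      using pP p0 P \<delta> by (intro add_left_mono mult_mono mult_right_mono) auto
    finally have 1: "p g * (1 + \<delta>) ^ D \<le> p g + P * (2 ^ D * \<delta>)" .
    have "L * (\<delta> + \<delta>\<^sup>2) * (1 + \<delta>) ^ D \<le> (L * (2 * \<delta>)) * 2 ^ D"
      using L \<delta> \<delta>2 by (intro mult_mono power_mono mult_left_mono) auto
    with 1 show ?thesis
      by (simp add: algebra_simps)
  qed
  finally have upper: "kde n \<delta> xs x - p x \<le> (2 ^ D * P + (2 * 2 ^ D + 1) * L + c / v) * \<delta>"
    using pxg unfolding kde by (simp add: algebra_simps abs_le_iff)

  have "n * ((p g - L * (\<delta> - \<delta>\<^sup>2)) * (v * (\<delta> - \<delta>\<^sup>2) ^ D)) - c * n * \<delta> ^ (D + 1) \<le> ?N g (\<delta> - \<delta>\<^sup>2)"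
    using lo q2 by (smt (verit) mult_left_mono of_nat_0_le_iff)
  also have "\<dots> \<le> ?N x \<delta>"
  proof (rule sum_mono)
    fix i
    have "cball g (\<delta> - \<delta>\<^sup>2) \<subseteq> cball x \<delta>"
      using g by (intro cball_subset_cball_iff[THEN iffD2]) (simp add: dist_commute)
    then show "indicator (cball g (\<delta> - \<delta>\<^sup>2)) (xs i) \<le> (indicator (cball x \<delta>) (xs i) :: real)"
      by (auto simp: indicator_def)
  qed
  finally have "(n * ((p g - L * (\<delta> - \<delta>\<^sup>2)) * (v * (\<delta> - \<delta>\<^sup>2) ^ D)) - c * n * \<delta> ^ (D + 1)) / a \<le> ?N x \<delta> / a"
    using a by (intro divide_right_mono) auto
  moreover have "(n * ((p g - L * (\<delta> - \<delta>\<^sup>2)) * (v * (\<delta> - \<delta>\<^sup>2) ^ D)) - c * n * \<delta> ^ (D + 1)) / a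
      = (p g - L * (\<delta> - \<delta>\<^sup>2)) * (1 - \<delta>) ^ D - c / v * \<delta>"
    unfolding diff_divide_distrib cterm e2 can ..
  \<comment> \<open>By Bernoulli's inequality the volume deficit of the smaller ball costs at most
    \<open>D * P * \<delta>\<close>.\<close>
  moreover have "p g - real D * P * \<delta> - L * \<delta> \<le> (p g - L * (\<delta> - \<delta>\<^sup>2)) * (1 - \<delta>) ^ D"
  proof -
    have "p g * (real D * \<delta>) \<le> P * (real D * \<delta>)"
      using pP \<delta> by (intro mult_right_mono) auto
    then have "p g - P * (real D * \<delta>) \<le> p g * (1 - real D * \<delta>)"
      by (simp add: algebra_simps)
    also have "\<dots> \<le> p g * (1 - \<delta>) ^ D"
      using one_minus_power_le[of \<delta> D] \<delta> p0 by (intro mult_left_mono) auto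
    finally have 1: "p g - P * (real D * \<delta>) \<le> p g * (1 - \<delta>) ^ D" .
    have "L * (\<delta> - \<delta>\<^sup>2) * (1 - \<delta>) ^ D \<le> (L * \<delta>) * 1"
      using L \<delta> \<delta>2 by (intro mult_mono power_le_one mult_left_mono) auto
    with 1 show ?thesis
      by (simp add: algebra_simps)
  qed
  ultimately have lower: "p x - kde n \<delta> xs x \<le> (real D * P + 2 * L + c / v) * \<delta>"
    using pxg unfolding kde by (simp add: algebra_simps abs_le_iff)
  have "2 ^ D * P + (2 * 2 ^ D + 1) * L + c / v \<le> 2 ^ D * P + real D * P + (2 * 2 ^ D + 2) * L + c / v"
    "real D * P + 2 * L + c / v \<le> 2 ^ D * P + real D * P + (2 * 2 ^ D + 2) * L + c / v"
    using P L by (simp_all add: algebra_simps)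
  then have "(2 ^ D * P + (2 * 2 ^ D + 1) * L + c / v) * \<delta> \<le> (2 ^ D * P + real D * P + (2 * 2 ^ D + 2) * L + c / v) * \<delta>"
    "(real D * P + 2 * L + c / v) * \<delta> \<le> (2 ^ D * P + real D * P + (2 * 2 ^ D + 2) * L + c / v) * \<delta>"
    using \<delta> by (simp_all add: mult_right_mono)
  with upper lower show ?thesis
    by linarith
qed

section \<open>Size of the bandwidth\<close>

text \<open>The last bound keeps the grid of mesh \<delta> squared quadratic in \<open>n\<close> in
  every dimension: as \<delta> is at most 1, the power \<open>\<delta> ^ (2 * D)\<close> is at least
  \<open>\<delta> ^ (2 * D + 4)\<close>, the square of \<open>ln n / n\<close>, and
  \<open>ln n\<close> is at least 1/2.\<close>

lemma bandwidth_props: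
  assumes n: "n \<ge> 2"
  shows "0 < bandwidth D n" "bandwidth D n \<le> 1" "bandwidth D n ^ (D + 2) = ln n / n"
    "1 / (bandwidth D n)\<^sup>2 ^ D \<le> 4 * (real n)\<^sup>2"
proof -
  have x: "0 < ln n / n" "ln n / n \<le> 1"
    using n ln_le_minus_one[of n] by (auto simp: field_simps)
  show 1: "0 < bandwidth D n" and 2: "bandwidth D n \<le> 1"
    unfolding bandwidth_def using x n by (auto intro: powr_le1)
  have "bandwidth D n ^ (D + 2) = bandwidth D n powr real (D + 2)"
    using 1 by (rule powr_realpow[symmetric])
  also have "\<dots> = ln n / n"
    unfolding bandwidth_def powr_powr using x n by simp
  finally show 3: "bandwidth D n ^ (D + 2) = ln n / n" .
  have "ln 2 \<le> ln (real n)"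
    using n by simp
  then have "1/2 \<le> ln (real n)"
    using ln2_ge_two_thirds by linarith
  then have "1 / (2 * real n) \<le> ln n / n"
    using n by (simp add: field_simps)
  then have "(1 / (2 * real n))\<^sup>2 \<le> (bandwidth D n ^ (D + 2))\<^sup>2"
    unfolding 3 by (intro power_mono) auto
  also have "\<dots> = ((bandwidth D n)\<^sup>2) ^ (D + 2)"
    by (simp only: power_mult[symmetric] mult.commute)
  also have "\<dots> \<le> ((bandwidth D n)\<^sup>2) ^ D"
    using 1 2 by (intro power_decreasing) (auto simp: power_le_one)
  finally have "1 / (bandwidth D n)\<^sup>2 ^ D \<le> 1 / (1 / (2 * real n))\<^sup>2"
    using n by (intro divide_left_mono) (auto simp: 1 less_imp_neq[symmetric])
  then show "1 / (bandwidth D n)\<^sup>2 ^ D \<le> 4 * (real n)\<^sup>2"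
    by (simp add: power2_eq_square)
qed

section \<open>Tail bounds at grid points and the union bound\<close>

text \<open>Radius and Chernoff parameter are of the same order, so \<open>q\<close> is of order
  \<open>\<bar>\<theta>\<bar> ^ D\<close> in dimension \<open>D\<close>, and the quadratic term of
  the Chernoff exponent is of order \<open>card I * \<bar>\<theta>\<bar> ^ (D + 2)\<close>.\<close>

lemma (in prob_space) prob_count_deviation:
  fixes X :: "nat \<Rightarrow> 'a \<Rightarrow> 'b::euclidean_space" and p :: "'b \<Rightarrow> real" and g :: 'b
    and v q r \<theta> T :: real
  defines "v \<equiv> measure lborel (cball (0 :: 'b) 1)"
  assumes fin: "finite I" and ind: "indep_vars (\<lambda>_. borel) X I"
    and dist: "\<And>i. i \<in> I \<Longrightarrow> distributed M lborel (X i) (\<lambda>x. ennreal (p x))"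
    and lip: "L-lipschitz_on UNIV p" and p0: "\<And>x. 0 \<le> p x" and pP: "\<And>x. p x \<le> P"
    and \<theta>: "\<bar>\<theta>\<bar> \<le> 1" and r: "0 \<le> r" "r \<le> 2 * \<bar>\<theta>\<bar>"
    and q: "\<And>i. i \<in> I \<Longrightarrow> prob {\<omega> \<in> space M. X i \<omega> \<in> cball g r} = q"
    and I: "I \<noteq> {}"
  shows "prob {\<omega> \<in> space M. \<theta> * (card I * q) + T \<le> \<theta> * (\<Sum>i\<in>I. indicator (cball g r) (X i \<omega>))}
      \<le> exp ((P + 2 * L) * v * 2 ^ DIM('b) * (card I * \<bar>\<theta>\<bar> ^ (DIM('b) + 2)) - T)"
proof -
  obtain i where i: "i \<in> I" using I by auto
  have L: "L \<ge> 0"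
    using lip by (rule lipschitz_on_nonneg)
  have P: "P \<ge> 0"
    using p0[of g] pP[of g] by linarith
  have meas: "measure lborel (cball g r) = v * r ^ DIM('b)"
    unfolding v_def using r(1) by (rule measure_cball_scale)
  have v: "v \<ge> 0" by (simp add: v_def)
  have "q \<le> (p g + L * r) * measure lborel (cball g r)"
    using prob_cball_lipschitz[OF dist[OF i] p0 lip, of g r] q[OF i] by (simp add: algebra_simps abs_le_iff)
  also have "\<dots> \<le> (P + L * 2) * (v * (2 * \<bar>\<theta>\<bar>) ^ DIM('b))"
    unfolding meas using r \<theta> L P v pP
    by (intro mult_mono add_mono mult_left_mono power_mono) auto
  finally have "card I * q * \<theta>\<^sup>2 \<le> card I * ((P + L * 2) * (v * (2 * \<bar>\<theta>\<bar>) ^ DIM('b))) * \<bar>\<theta>\<bar>\<^sup>2"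
    by (simp add: mult_left_mono mult_right_mono)
  also have "\<dots> = (P + 2 * L) * v * 2 ^ DIM('b) * (card I * \<bar>\<theta>\<bar> ^ (DIM('b) + 2))"
    by (simp only: power_mult_distrib power_add) (simp add: algebra_simps)
  finally show ?thesis
    using chernoff_count[OF fin ind _ q \<theta>, where T = T] by (smt (verit) borel_closed closed_cball exp_le_cancel_iff)
qed

lemma (in prob_space) kde_uniform_consistency:
  fixes X :: "nat \<Rightarrow> 'a \<Rightarrow> real ^ 'm" and p :: "real ^ 'm \<Rightarrow> real"
  assumes lip: "L-lipschitz_on UNIV p" and p0: "\<And>x. 0 \<le> p x" and pP: "\<And>x. p x \<le> P"
    and supp: "\<And>x. x \<notin> unit_cube \<Longrightarrow> p x = 0"
    and ind: "indep_vars (\<lambda>_. borel) X {1..}"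
    and dist: "\<And>i. i \<ge> 1 \<Longrightarrow> distributed M lborel (X i) (\<lambda>x. ennreal (p x))"
  shows "\<exists>c'>0. \<forall>n\<ge>2.
      prob {\<omega> \<in> space M. sup_norm (\<lambda>x. kde n (bandwidth CARD('m) n) (\<lambda>i. X i \<omega>) x - p x)
               \<le> ereal (c' * bandwidth CARD('m) n)} \<ge> 1 - 2 / real n"
proof -
  define D where "D = CARD('m)"
  define v where "v = measure lborel (cball (0 :: real ^ 'm) 1)"
  define M' where "M' = (P + 2 * L) * v * 2 ^ D"
  define B where "B = 4 * (7 * real D) ^ D"
  \<comment> \<open>Chosen so that \<open>B * n\<^sup>2\<close> grid points, each with tail
    \<open>n powr (M' - c)\<close>, contribute at most \<open>1 / n\<close>: \<open>log 2 B\<close>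
    absorbs \<open>B\<close> because \<open>n \<ge> 2\<close>, and 3 = 2 + 1 pays for the square and
    for the final \<open>1 / n\<close>.\<close>
  define c where "c = M' + 3 + log 2 B"
  define c' where "c' = 2 ^ D * P + real D * P + (2 * 2 ^ D + 2) * L + c / v"
  have D: "D \<ge> 1"
    unfolding D_def using zero_less_card_finite[where 'a='m] by linarith
  have v: "v > 0"
    unfolding v_def by (rule content_cball_pos) simp
  have L: "L \<ge> 0"
    using lip by (rule lipschitz_on_nonneg)
  have P: "P \<ge> 0"
    using p0[of 0] pP[of 0] by linarith
  have M': "M' \<ge> 0"
    using v L P by (simp add: M'_def)
  have B: "B \<ge> 1"
    unfolding B_def using one_le_power[of "7 * real D" D] D by linarith
  then have logB: "log 2 B \<ge> 0"
    by simp
  have c: "c > 0"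
    using M' logB by (simp add: c_def)
  have c': "c' > 0"
    unfolding c'_def using P L c v by (intro add_nonneg_pos add_nonneg_nonneg) auto
  have rv: "X i \<in> borel_measurable M" if "i \<ge> 1" for i
    using distributed_measurable[OF dist[OF that]] by simp
  have q_eq: "prob {\<omega> \<in> space M. X i \<omega> \<in> cball g r} = prob {\<omega> \<in> space M. X 1 \<omega> \<in> cball g r}"
    if "i \<ge> 1" for i g r
  proof -
    have "emeasure M (X i -` cball g r \<inter> space M) = emeasure M (X 1 -` cball g r \<inter> space M)"
      using distributed_emeasure[OF dist[OF that], of "cball g r"] distributed_emeasure[OF dist[of 1], of "cball g r"]
      by simp
    then show ?thesis
      by (simp add: measure_def vimage_def Collect_conj_eq Int_commute)
  qed
  define q where "q g r = prob {\<omega> \<in> space M. X 1 \<omega> \<in> cball g r}" for g r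
  have q: "\<bar>q g r - p g * (v * r ^ D)\<bar> \<le> L * r * (v * r ^ D)" if "r \<ge> 0" for g r
    using prob_cball_lipschitz[OF dist[of 1] p0 lip, of g r]
    unfolding measure_cball_scale[OF that] q_def v_def D_def by simp
  \<comment> \<open>Confining the samples to the cube handles the points \<open>x\<close> that the
    grid does not reach.\<close>
  have supp_AE: "AE \<omega> in M. X i \<omega> \<in> unit_cube" if "i \<ge> 1" for i
  proof -
    have meas: "- unit_cube \<in> sets lborel"
      by (simp add: borel_closed closed_cbox)
    have "emeasure M (X i -` (- unit_cube) \<inter> space M) = (\<integral>\<^sup>+x. ennreal (p x) * indicator (- unit_cube) x \<partial>lborel)"
      by (rule distributed_emeasure[OF dist[OF that] meas])
    also have "\<dots> = (\<integral>\<^sup>+x. 0 \<partial>(lborel :: (real ^ 'm) measure))"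
      by (intro nn_integral_cong) (use supp in \<open>auto simp: indicator_def\<close>)
    finally have "X i -` (- unit_cube) \<inter> space M \<in> null_sets M"
      using measurable_sets[OF rv[OF that], of "- unit_cube"] meas by auto
    then show ?thesis
      by (rule AE_I') auto
  qed

  have main: "prob {\<omega> \<in> space M. sup_norm (\<lambda>x. kde n (bandwidth D n) (\<lambda>i. X i \<omega>) x - p x)
               \<le> ereal (c' * bandwidth D n)} \<ge> 1 - 2 / real n" if n: "n \<ge> 2" for n
  proof -
    define \<delta> where "\<delta> = bandwidth D n"
    note \<delta> = bandwidth_props[OF n, of D, folded \<delta>_def]
    have \<delta>2: "0 < \<delta>\<^sup>2" "\<delta>\<^sup>2 \<le> \<delta>" "\<delta>\<^sup>2 \<le> 1"
      using \<delta> by (simp_all add: power2_eq_square mult_left_le mult_le_one)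
    define N where "N y r \<omega> = (\<Sum>i\<in>{1..n}. indicator (cball y r) (X i \<omega>) :: real)" for y r \<omega>
    define Good where "Good = {\<omega> \<in> space M. sup_norm (\<lambda>x. kde n \<delta> (\<lambda>i. X i \<omega>) x - p x) \<le> ereal (c' * \<delta>)}"
    have Good_iff: "Good = {\<omega> \<in> space M. \<forall>x. \<bar>kde n \<delta> (\<lambda>i. X i \<omega>) x - p x\<bar> \<le> c' * \<delta>}"
      by (simp add: Good_def sup_norm_def SUP_le_iff)
    have "Good \<in> events"
      unfolding Good_iff kde_eq[OF \<delta>(1)]
      by (rule measurable_uniform_deviation)
         (use rv \<delta>(1) lip in \<open>auto intro: lipschitz_on_continuous_on\<close>)
    obtain G :: "(real ^ 'm) set" where G: "finite G" "real (card G) \<le> (7 * D / \<delta>\<^sup>2) ^ D"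
      "\<And>x. (\<And>i. \<bar>x $ i\<bar> \<le> 2) \<Longrightarrow> \<exists>g\<in>G. dist x g \<le> \<delta>\<^sup>2"
      using grid_cover[OF \<delta>2(1) \<delta>2(3)] unfolding D_def by metis
    \<comment> \<open>\<open>U g\<close> means too many samples in the enlarged ball,
      \<open>V g\<close> too few in the shrunken one. The two use opposite signs of the Chernoff
      parameter.\<close>
    define U where "U g = {\<omega> \<in> space M. \<delta> * (n * q g (\<delta> + \<delta>\<^sup>2)) + c * ln n \<le> \<delta> * N g (\<delta> + \<delta>\<^sup>2) \<omega>}" for g
    define V where "V g = {\<omega> \<in> space M. -\<delta> * (n * q g (\<delta> - \<delta>\<^sup>2)) + c * ln n \<le> -\<delta> * N g (\<delta> - \<delta>\<^sup>2) \<omega>}" for g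
    have indn: "indep_vars (\<lambda>_. borel) X {1..n}"
      by (rule indep_vars_subset[OF ind]) auto
    have Nmeas: "N g r \<in> borel_measurable M" for g r
      unfolding N_def[abs_def]
      by (intro borel_measurable_sum measurable_compose[OF rv] borel_measurable_indicator) auto
    have [measurable]: "U g \<in> events" "V g \<in> events" for g
      unfolding U_def V_def using Nmeas[measurable] by measurable
    \<comment> \<open>This identity fixes the rate: both the Chernoff exponent and the threshold
      become multiples of \<open>ln n\<close>, so the tails are powers of \<open>n\<close>.\<close>
    have nd: "n * \<delta> ^ (D + 2) = ln n"
      using \<delta>(3) n by simp
    have qi: "prob {\<omega> \<in> space M. X i \<omega> \<in> cball g r} = q g r" if "i \<in> {1..n}" for i g r
      unfolding q_def using that by (intro q_eq) simp
    have tail: "prob {\<omega> \<in> space M. \<theta> * (n * q g r) + c * ln n \<le> \<theta> * N g r \<omega>} \<le> exp ((M' - c) * ln n)"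
      if "\<bar>\<theta>\<bar> = \<delta>" "0 \<le> r" "r \<le> 2 * \<delta>" for \<theta> r g
    proof -
      have "prob {\<omega> \<in> space M. \<theta> * (card {1..n} * q g r) + c * ln n \<le> \<theta> * (\<Sum>i\<in>{1..n}. indicator (cball g r) (X i \<omega>))}
        \<le> exp ((P + 2 * L) * measure lborel (cball (0 :: real ^ 'm) 1) * 2 ^ DIM(real ^ 'm) *
            (card {1..n} * \<bar>\<theta>\<bar> ^ (DIM(real ^ 'm) + 2)) - c * ln n)"
        using that \<delta>(1,2) n by (intro prob_count_deviation[OF _ indn dist lip p0 pP _ _ _ qi]) auto
      then show ?thesis
        using nd unfolding N_def that(1) M'_def v_def[symmetric]
        by (simp add: D_def[symmetric] left_diff_distrib)
    qed
    have tailU: "prob (U g) \<le> exp ((M' - c) * ln n)" for g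
      unfolding U_def using \<delta>(1,2) \<delta>2 by (intro tail) linarith+
    have tailV: "prob (V g) \<le> exp ((M' - c) * ln n)" for g
      unfolding V_def using \<delta>(1,2) \<delta>2 by (intro tail) linarith+

    have "real (card G) \<le> (7 * D) ^ D * (1 / \<delta>\<^sup>2 ^ D)"
      using G(2) by (simp add: power_divide)
    also have "\<dots> \<le> (7 * D) ^ D * (4 * (real n)\<^sup>2)"
      using \<delta>(4) by (intro mult_left_mono) auto
    also have "\<dots> = B * (real n)\<^sup>2"
      by (simp add: B_def)
    finally have cardG: "real (card G) \<le> B * (real n)\<^sup>2" .
    have "B = exp (log 2 B * ln 2)"
      using B by (simp add: log_def)
    also have "\<dots> \<le> exp (log 2 B * ln n)"
      using logB n by (auto intro: mult_left_mono)
    finally have Bn: "B \<le> exp (log 2 B * ln n)" .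
    have n2: "(real n)\<^sup>2 = exp (2 * ln n)"
      using n by (simp add: exp_double)
    have "real (card G) * exp ((M' - c) * ln n) \<le> exp (log 2 B * ln n) * exp (2 * ln n) * exp ((M' - c) * ln n)"
      using cardG Bn unfolding n2 by (meson exp_ge_zero mult_right_mono order_trans)
    also have "\<dots> = exp (- ln n)"
      unfolding exp_add[symmetric] c_def by (simp add: algebra_simps)
    also have "\<dots> = 1 / n"
      using n by (simp add: exp_minus field_simps)
    finally have union: "real (card G) * exp ((M' - c) * ln n) \<le> 1 / n" .

    \<comment> \<open>The deterministic part: if all samples lie in the cube, a failure of the
      uniform bound forces an exceptional event at some grid point.\<close>
    have step: "\<omega> \<in> (\<Union>g\<in>G. U g \<union> V g)"
      if \<omega>: "\<omega> \<in> space M - Good" and cube: "\<And>i. i \<in> {1..n} \<Longrightarrow> X i \<omega> \<in> unit_cube" for \<omega>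
    proof (rule ccontr)
      assume none: "\<omega> \<notin> (\<Union>g\<in>G. U g \<union> V g)"
      have "\<bar>kde n \<delta> (\<lambda>i. X i \<omega>) x - p x\<bar> \<le> c' * \<delta>" for x
      proof (cases "\<forall>i. \<bar>x $ i\<bar> \<le> 2")
        case True
        then obtain g where g: "g \<in> G" "dist x g \<le> \<delta>\<^sup>2"
          using G(3) by blast
        \<comment> \<open>Written this way, the threshold can be divided by \<delta>, leaving the
          deviation of the counts themselves.\<close>
        have cln: "c * ln n = \<delta> * (c * n * \<delta> ^ (D + 1))"
          using nd by (simp add: algebra_simps)
        have "\<delta> * N g (\<delta> + \<delta>\<^sup>2) \<omega> \<le> \<delta> * (n * q g (\<delta> + \<delta>\<^sup>2) + c * n * \<delta> ^ (D + 1))"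
          "\<delta> * (n * q g (\<delta> - \<delta>\<^sup>2) - c * n * \<delta> ^ (D + 1)) \<le> \<delta> * N g (\<delta> - \<delta>\<^sup>2) \<omega>"
          using none g(1) \<omega> unfolding U_def V_def cln by (auto simp: algebra_simps not_le)
        then have "N g (\<delta> + \<delta>\<^sup>2) \<omega> \<le> n * q g (\<delta> + \<delta>\<^sup>2) + c * n * \<delta> ^ (D + 1)"
          "n * q g (\<delta> - \<delta>\<^sup>2) - c * n * \<delta> ^ (D + 1) \<le> N g (\<delta> - \<delta>\<^sup>2) \<omega>"
          using \<delta>(1) by simp_all
        moreover have "q g (\<delta> + \<delta>\<^sup>2) \<le> (p g + L * (\<delta> + \<delta>\<^sup>2)) * (v * (\<delta> + \<delta>\<^sup>2) ^ D)"
          "(p g - L * (\<delta> - \<delta>\<^sup>2)) * (v * (\<delta> - \<delta>\<^sup>2) ^ D) \<le> q g (\<delta> - \<delta>\<^sup>2)"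
          using q[of "\<delta> + \<delta>\<^sup>2" g] q[of "\<delta> - \<delta>\<^sup>2" g] \<delta>(1) \<delta>2
          unfolding left_diff_distrib[of "p g"] distrib_right[of "p g"] by linarith+
        ultimately show ?thesis
          unfolding c'_def D_def v_def N_def
          using n c by (intro kde_sandwich[OF \<delta>(1,2) _ _ lip p0 pP g(2)]) auto
      next
        \<comment> \<open>A coordinate beyond 2 in absolute value puts \<open>x\<close> at distance
          more than 1 from every sample, so estimator and density both vanish there.\<close>
        case False
        then obtain j where j: "\<bar>x $ j\<bar> > 2" by (auto simp: not_le)
        then have "x \<notin> unit_cube"
          by (auto simp: mem_box_cart intro!: exI[of _ j])
        then have "p x = 0" by (rule supp)
        moreover have "X i \<omega> \<notin> cball x \<delta>" if "i \<in> {1..n}" for i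
        proof -
          have "0 \<le> X i \<omega> $ j" "X i \<omega> $ j \<le> 1"
            using cube[OF that] by (auto simp: mem_box_cart)
          then have "1 < \<bar>(x - X i \<omega>) $ j\<bar>"
            using j by auto
          also have "\<dots> \<le> norm (x - X i \<omega>)"
            by (rule component_le_norm_cart)
          finally show ?thesis
            using \<delta>(2) by (simp add: dist_norm)
        qed
        then have "kde n \<delta> (\<lambda>i. X i \<omega>) x = 0"
          unfolding kde_eq[OF \<delta>(1)] by (simp add: indicator_def sum.neutral)
        ultimately show ?thesis
          using c' \<delta>(1) by simp
      qed
      then show False
        using \<omega> by (simp add: Good_iff)
    qed
    have "prob (space M - Good) \<le> prob (\<Union>g\<in>G. U g \<union> V g)"
    proof (rule finite_measure_mono_AE)
      have "AE \<omega> in M. \<forall>i\<in>{1..n}. X i \<omega> \<in> unit_cube"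
        by (rule AE_finite_allI) (auto intro: supp_AE)
      then show "AE \<omega> in M. \<omega> \<in> space M - Good \<longrightarrow> \<omega> \<in> (\<Union>g\<in>G. U g \<union> V g)"
        by eventually_elim (use step in blast)
    qed (use G(1) in auto)
    also have "\<dots> \<le> (\<Sum>g\<in>G. prob (U g \<union> V g))"
      using G(1) by (intro measure_UNION_le) auto
    \<comment> \<open>The factor 2 counts the upper and the lower tail, and is the 2 in
      \<open>2 / n\<close>.\<close>
    also have "\<dots> \<le> (\<Sum>g\<in>G. 2 * exp ((M' - c) * ln n))"
    proof (rule sum_mono)
      fix g
      have "prob (U g \<union> V g) \<le> prob (U g) + prob (V g)"
        by (rule measure_Un_le) auto
      then show "prob (U g \<union> V g) \<le> 2 * exp ((M' - c) * ln n)"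
        using tailU[of g] tailV[of g] by linarith
    qed
    also have "\<dots> \<le> 2 / n"
      using union by simp
    finally have "prob (space M - Good) \<le> 2 / n" .
    then show ?thesis
      using prob_compl[OF \<open>Good \<in> events\<close>] unfolding Good_def \<delta>_def by linarith
  qed
  show ?thesis
    using main c' unfolding D_def by blast
qed

theorem theorem5p2p1:
  fixes s d :: nat
    and p :: "real ^ 'm \<Rightarrow> real"
    and M :: "'w measure"
    and X :: "nat \<Rightarrow> 'w \<Rightarrow> real ^ 'm"
  assumes "s \<ge> 1" and "d \<ge> 1" and "CARD('m) = s * d"
    and "mixture_density p"
    and "prob_space M"
    and "prob_space.indep_vars M (\<lambda>_. borel) X {1..}"
    and "\<And>i. i \<ge> 1 \<Longrightarrow> distributed M lborel (X i) (\<lambda>x. ennreal (p x))"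
  shows "\<exists>c'>0. \<forall>n\<ge>2.
           measure M {\<omega> \<in> space M.
             sup_norm (\<lambda>x. kde n (bandwidth (s * d) n) (\<lambda>i. X i \<omega>) x - p x)
               \<le> ereal (c' * (ln (real n) / real n) powr (1 / (2 + real (s * d))))}
           \<ge> 1 - 2 / real n"
proof -
  obtain L P where "L-lipschitz_on UNIV p" "\<And>x. 0 \<le> p x" "\<And>x. p x \<le> P"
    "\<And>x. x \<notin> unit_cube \<Longrightarrow> p x = 0"
    using mixture_density_props[OF assms(4)] by blast
  from prob_space.kde_uniform_consistency[OF assms(5) this assms(6,7)]
  show ?thesis
    unfolding assms(3) bandwidth_def[of "s * d"] .
qed

end
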